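(* Let $\mathcal{A}\in\mathbb{C}^{n\times n\times n\times n}$ be a conjugate partial-symmetric tensor, written as $$\mathcal{A}=\sum_{i=1}^{\operatorname{rank}_M(\mathcal{A})}\lambda_i\,E_i\circ\overline{E_i},\qquad \lambda_i\in\mathbb{R},\ E_i\in\mathbb{C}^{n\times n},\ E_i^T=E_i .$$ Then $$\operatorname{rank}_M(\mathcal{A})\le\operatorname{rank}_{CP}(\mathcal{A})\le r^2\operatorname{rank}_M(\mathcal{A}),$$ where $r=\max_i\operatorname{rank}(E_i)$.
   Context: A tensor $\mathcal{A}\in\mathbb{C}^{n\times n\times n\times n}$ is conjugate partial-symmetric (CPS) if for all $i,j,k,l$: $\mathcal{A}_{ijkl}=\mathcal{A}_{jikl}=\mathcal{A}_{ijlk}$ and $\mathcal{A}_{ijkl}=\overline{\mathcal{A}_{klij}}$. For $X,Y\in\mathbb{C}^{n\times n}$, $(X\circ Y)_{ijkl}=X_{ij}Y_{kl}$; $\overline X$ is the entrywise conjugate. $\operatorname{rank}_M(\mathcal{A})$ is the least $r$ such that $\mathcal{A}=\sum_{i=1}^r\lambda_iE_i\circ\overline{E_i}$ with $\lambda_i\in\mathbb{R}$ and $E_i\in\mathbb{C}^{n\times n}$ symmetric. $\operatorname{rank}_{CP}(\mathcal{A})$ is the least $R$ such that $\mathcal{A}$ is a sum of $R$ tensors of the form $a\circ b\circ c\circ d$ with $a,b,c,d\in\mathbb{C}^n$, where $(a\circ b\circ c\circ d)_{ijkl}=a_ib_jc_kd_l$. *)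

theory Defs
  imports "HOL-Analysis.Analysis"
begin

type_synonym 'n tensor4 = "complex^'n^'n^'n^'n"

definition cps :: "('n::finite) tensor4 \<Rightarrow> bool" where
  "cps A \<longleftrightarrow> (\<forall>i j k l.
      A $ i $ j $ k $ l = A $ j $ i $ k $ l \<and>
      A $ i $ j $ k $ l = A $ i $ j $ l $ k \<and>
      A $ i $ j $ k $ l = cnj (A $ k $ l $ i $ j))"

definition mat_outer :: "complex^'n^'n \<Rightarrow> complex^'n^'n \<Rightarrow> ('n::finite) tensor4" where
  "mat_outer X Y = (\<chi> i j k l. X $ i $ j * Y $ k $ l)"

definition mat_cnj :: "complex^'n^'n \<Rightarrow> complex^'n^('n::finite)" where
  "mat_cnj X = (\<chi> i j. cnj (X $ i $ j))"

definition vec_outer ::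
  "complex^'n \<Rightarrow> complex^'n \<Rightarrow> complex^'n \<Rightarrow> complex^'n \<Rightarrow> ('n::finite) tensor4" where
  "vec_outer a b c d = (\<chi> i j k l. a $ i * b $ j * c $ k * d $ l)"

text \<open>
  A decomposition as below exists only for tensors satisfying \<^const>\<open>cps\<close>;
  for other tensors the value of \<open>rank_M\<close> is meaningless.
\<close>

definition rank_M :: "('n::finite) tensor4 \<Rightarrow> nat" where
  "rank_M A = (LEAST r. \<exists>(c :: nat \<Rightarrow> real) (E :: nat \<Rightarrow> complex^'n^'n).
      (\<forall>i\<in>{1..r}. transpose (E i) = E i) \<and>
      A = (\<Sum>i=1..r. c i *\<^sub>R mat_outer (E i) (mat_cnj (E i))))"

definition rank_CP :: "('n::finite) tensor4 \<Rightarrow> nat" where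
  "rank_CP A = (LEAST R. \<exists>(a :: nat \<Rightarrow> complex^'n) b c d.
      A = (\<Sum>i=1..R. vec_outer (a i) (b i) (c i) (d i)))"

end

theory Submission
  imports Defs
begin

text \<open>
  Both inequalities come from viewing the tensor as a matrix whose rows and columns are indexed
  by pairs: \<open>M (i, j) (k, l) = A i j k l\<close>. Conjugate symmetry of \<open>A\<close> says that \<open>M\<close> is Hermitian.

  For the lower bound, a CP decomposition with \<open>R\<close> terms writes \<open>M\<close> as a sum of \<open>R\<close> rank-one
  matrices \<open>(a \<circ> b) (c \<circ> d)\<^sup>T\<close>, so the range of \<open>M\<close> has dimension at most \<open>R\<close>
  (\<open>dim_range_sum_rank_one\<close>). A Hermitian matrix whose range has dimension at most \<open>R\<close> is a real
  combination of \<open>R\<close> terms \<open>e e\<^sup>*\<close> with every \<open>e\<close> in its range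
  (\<open>hermitian_sum_rank_one\<close>). Partial symmetry of \<open>A\<close> makes every vector in the range of \<open>M\<close> a
  symmetric matrix once its index pairs are split again, so the terms \<open>e e\<^sup>*\<close> are exactly the
  terms \<open>E \<circ> cnj E\<close> that \<open>rank_M\<close> counts.
  The decomposition of \<open>M\<close> is obtained without eigenvectors, by Lagrange's reduction of a
  Hermitian form: subtract one multiple of \<open>e e\<^sup>*\<close> so that the dimension of the range drops.

  For the upper bound, each \<open>E i\<close> is a sum of \<open>rank (E i)\<close> products \<open>u v\<^sup>T\<close>
  (\<open>rank_factorization\<close>). Multiplying out \<open>E i \<circ> cnj (E i)\<close> gives \<open>(rank (E i))\<^sup>2\<close> terms
  \<open>u \<circ> v \<circ> cnj u' \<circ> cnj v'\<close>.
\<close>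

section \<open>Hermitian matrices as real combinations of rank-one matrices\<close>

definition hermitian :: "complex^'m^'m \<Rightarrow> bool" where
  "hermitian M \<longleftrightarrow> (\<forall>p q. M $ p $ q = cnj (M $ q $ p))"

definition hdot :: "complex^'m \<Rightarrow> complex^'m \<Rightarrow> complex" where
  "hdot x y = (\<Sum>p\<in>UNIV. cnj (x $ p) * y $ p)"

lemma hdot_add_left: "hdot (x + y) z = hdot x z + hdot y z"
  by (simp add: hdot_def algebra_simps sum.distrib)

lemma hdot_add_right: "hdot z (x + y) = hdot z x + hdot z y"
  by (simp add: hdot_def algebra_simps sum.distrib)

lemma hdot_diff_right: "hdot z (x - y) = hdot z x - hdot z y"
  by (simp add: hdot_def algebra_simps sum_subtractf)

lemma hdot_scale_left: "hdot (k *s x) y = cnj k * hdot x y"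
  by (simp add: hdot_def sum_distrib_left mult.assoc)

lemma hdot_scale_right: "hdot x (k *s y) = k * hdot x y"
  by (simp add: hdot_def sum_distrib_left mult.left_commute)

lemma hdot_commute: "hdot x y = cnj (hdot y x)"
  by (simp add: hdot_def mult.commute)

lemma hdot_axis_matrix: "hdot (axis p 1) (M *v axis q 1) = M $ p $ q"
proof -
  have "hdot (axis p 1) (M *v axis q 1) = (M *v axis q 1) $ p"
    by (simp add: hdot_def axis_def if_distrib[where f = cnj] if_distrib[where f = "\<lambda>t. t * _"]
        cong: if_cong)
  also have "\<dots> = M $ p $ q"
    by (simp add: matrix_vector_mult_def axis_def if_distrib[where f = "(*) _"] cong: if_cong)
  finally show ?thesis .
qed

lemma hermitian_adjoint:
  assumes "hermitian M"
  shows "hdot x (M *v y) = hdot (M *v x) y"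
proof -
  have "hdot x (M *v y) = (\<Sum>p\<in>UNIV. \<Sum>q\<in>UNIV. cnj (x $ p) * (M $ p $ q * y $ q))"
    by (simp add: hdot_def matrix_vector_mult_def sum_distrib_left)
  also have "\<dots> = (\<Sum>p\<in>UNIV. \<Sum>q\<in>UNIV. cnj (M $ q $ p) * cnj (x $ p) * y $ q)"
  proof (intro sum.cong refl)
    fix p q
    have "M $ p $ q = cnj (M $ q $ p)" using assms unfolding hermitian_def by blast
    then show "cnj (x $ p) * (M $ p $ q * y $ q) = cnj (M $ q $ p) * cnj (x $ p) * y $ q"
      by (simp only: mult_ac)
  qed
  also have "\<dots> = (\<Sum>q\<in>UNIV. \<Sum>p\<in>UNIV. cnj (M $ q $ p) * cnj (x $ p) * y $ q)"
    by (rule sum.swap)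
  also have "\<dots> = hdot (M *v x) y"
    by (simp add: hdot_def matrix_vector_mult_def sum_distrib_right)
  finally show ?thesis .
qed

text \<open>
  Polarization: if the quadratic form vanishes identically, its values at \<open>x + k y\<close> for
  \<open>k = 1\<close> and \<open>k = \<i>\<close> force the sesquilinear form, and with it every matrix entry, to vanish.
\<close>

lemma exists_nonisotropic:
  fixes M :: "complex^'m^('m::finite)"
  assumes "M \<noteq> 0"
  obtains z where "hdot z (M *v z) \<noteq> 0"
proof (rule ccontr)
  assume "\<not> thesis"
  with that have isotropic: "hdot z (M *v z) = 0" for z by blast
  have polar: "k * hdot x (M *v y) + cnj k * hdot y (M *v x) = 0" for k x y
    using isotropic[of "x + k *s y"] isotropic[of x] isotropic[of y]
    by (simp add: vec.add vec.scale hdot_add_left hdot_add_right hdot_scale_left hdot_scale_right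
        add.commute)
  have "hdot x (M *v y) = 0" for x y
    using polar[of 1 x y] polar[of \<i> x y] by simp
  then have "M $ p $ q = 0" for p q
    by (metis hdot_axis_matrix)
  then have "M = 0" by (simp add: vec_eq_iff)
  with assms show False by simp
qed

text \<open>
  One step of Lagrange's reduction. With \<open>e = M z\<close> and \<open>h = z\<^sup>* M z \<noteq> 0\<close>, the matrix
  \<open>M - e e\<^sup>* / h\<close> has its range inside that of \<open>M\<close> and inside the orthogonal complement of \<open>z\<close>.
  The vector \<open>e\<close> lies in the first but not in the second, so the dimension drops.
\<close>

lemma hermitian_reduction:
  fixes M :: "complex^'m^('m::finite)"
  assumes herm: "hermitian M" and "M \<noteq> 0"
  obtains M' e and c :: real where
    "hermitian M'" "e \<in> range ((*v) M)" "range ((*v) M') \<subseteq> range ((*v) M)"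
    "vec.dim (range ((*v) M')) < vec.dim (range ((*v) M))"
    "\<And>p q. M $ p $ q = M' $ p $ q + of_real c * e $ p * cnj (e $ q)"
proof -
  obtain z where z: "hdot z (M *v z) \<noteq> 0"
    using exists_nonisotropic[OF \<open>M \<noteq> 0\<close>] .
  define e where "e = M *v z"
  define h where "h = hdot z e"
  define c where "c = 1 / Re h"
  \<comment> \<open>The Hermitian form takes real values, which makes the coefficient \<open>1 / h\<close> real.\<close>
  have "cnj h = hdot e z"
    unfolding h_def by (rule hdot_commute[symmetric])
  also have "\<dots> = h"
    unfolding h_def e_def by (rule hermitian_adjoint[OF herm, symmetric])
  finally have "cnj h = h" .
  then have "Im h = 0" by (simp add: complex_eq_iff)
  then have h_real: "h = of_real (Re h)" by (simp add: complex_eq_iff)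
  have h: "h \<noteq> 0" using z by (simp add: h_def e_def)
  with \<open>Im h = 0\<close> have "Re h \<noteq> 0" by (auto simp: complex_eq_iff)
  then have ch: "of_real c * h = 1"
    by (subst h_real) (simp add: c_def flip: of_real_mult)
  define M' where "M' = (\<chi> p q. M $ p $ q - of_real c * e $ p * cnj (e $ q))"
  have herm': "hermitian M'"
    unfolding hermitian_def
  proof (intro allI)
    fix p q
    have "M $ p $ q = cnj (M $ q $ p)" using herm unfolding hermitian_def by blast
    then show "M' $ p $ q = cnj (M' $ q $ p)" unfolding M'_def by (simp add: mult_ac)
  qed
  have M'_vec: "M' *v x = M *v x - (of_real c * hdot e x) *s e" for x
  proof -
    have "(M' *v x) $ p = (M *v x) $ p - of_real c * hdot e x * e $ p" for p
    proof -
      have "(M' *v x) $ p =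
          (\<Sum>q\<in>UNIV. M $ p $ q * x $ q - of_real c * (cnj (e $ q) * x $ q) * e $ p)"
        unfolding M'_def matrix_vector_mult_def by (simp add: algebra_simps)
      also have "\<dots> = (M *v x) $ p - of_real c * hdot e x * e $ p"
        by (simp add: sum_subtractf matrix_vector_mult_def hdot_def flip: sum_distrib_left sum_distrib_right)
      finally show ?thesis .
    qed
    then show ?thesis by (simp add: vec_eq_iff)
  qed
  have "M' *v x = M *v (x - (of_real c * hdot e x) *s z)" for x
    by (simp add: M'_vec vec.diff vec.scale e_def)
  then have sub: "range ((*v) M') \<subseteq> range ((*v) M)" by auto
  have orth: "hdot z (M' *v x) = 0" for x
  proof -
    have "hdot z (M' *v x) = hdot e x - (of_real c * h) * hdot e x"
      by (simp add: M'_vec hdot_diff_right hdot_scale_right hermitian_adjoint[OF herm] e_def h_def)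
    then show ?thesis by (simp add: ch)
  qed
  have e_range: "e \<in> range ((*v) M)" by (simp add: e_def)
  have "e \<notin> range ((*v) M')" using orth h by (auto simp: h_def)
  with sub e_range have "range ((*v) M') \<subset> range ((*v) M)" by blast
  moreover have span_range: "vec.span (range ((*v) N)) = range ((*v) N)" for N :: "complex^'m^'m"
    by (intro vec.span_eq_iff[THEN iffD2] vec.subspace_image vec.subspace_UNIV)
  ultimately have "vec.span (range ((*v) M')) \<subset> vec.span (range ((*v) M))"
    by (simp only: span_range[of M] span_range[of M'])
  then have drop: "vec.dim (range ((*v) M')) < vec.dim (range ((*v) M))"
    by (rule vec.dim_psubset)
  have "M $ p $ q = M' $ p $ q + of_real c * e $ p * cnj (e $ q)" for p q
    by (simp add: M'_def)
  then show thesis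
    by (rule that[OF herm' e_range sub drop])
qed

lemma hermitian_sum_rank_one:
  fixes M :: "complex^'m^('m::finite)"
  assumes "hermitian M" "vec.dim (range ((*v) M)) \<le> R"
  shows "\<exists>(c :: nat \<Rightarrow> real) e. (\<forall>t. e t \<in> range ((*v) M)) \<and>
           (\<forall>p q. M $ p $ q = (\<Sum>t=1..R. of_real (c t) * e t $ p * cnj (e t $ q)))"
  using assms
proof (induction R arbitrary: M)
  case (0 M)
  have "M = 0"
  proof (rule ccontr)
    assume "M \<noteq> 0"
    from hermitian_reduction[OF 0(1) this] show False using 0(2) by (metis le_zero_eq not_less_zero)
  qed
  then show ?case by (intro exI[of _ "\<lambda>_. 0"]) auto
next
  case (Suc R M)
  show ?case
  proof (cases "M = 0")
    case True
    then show ?thesis by (intro exI[of _ "\<lambda>_. 0"]) auto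
  next
    case False
    obtain M' f and d :: real where red: "hermitian M'" "f \<in> range ((*v) M)"
      "range ((*v) M') \<subseteq> range ((*v) M)"
      "vec.dim (range ((*v) M')) < vec.dim (range ((*v) M))"
      "\<And>p q. M $ p $ q = M' $ p $ q + of_real d * f $ p * cnj (f $ q)"
      using hermitian_reduction[OF Suc.prems(1) False] by metis
    have "vec.dim (range ((*v) M')) \<le> R" using red(4) Suc.prems(2) by linarith
    from Suc.IH[OF red(1) this] obtain c :: "nat \<Rightarrow> real" and e where
      e: "\<And>t. e t \<in> range ((*v) M')" and
      M': "\<And>p q. M' $ p $ q = (\<Sum>t=1..R. of_real (c t) * e t $ p * cnj (e t $ q))" by blast
    have "M $ p $ q = (\<Sum>t=1..Suc R. of_real ((c(Suc R := d)) t) *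
        (e(Suc R := f)) t $ p * cnj ((e(Suc R := f)) t $ q))" for p q
      by (simp add: red(5) M')
    moreover have "(e(Suc R := f)) t \<in> range ((*v) M)" for t
      using e[of t] red(2,3) by auto
    ultimately show ?thesis by blast
  qed
qed

section \<open>Sums of rank-one matrices and rank\<close>

lemma dim_range_sum_rank_one:
  fixes M :: "'a::field^'n^'m"
  assumes "\<And>p q. M $ p $ q = (\<Sum>t=1..R. x t $ p * y t $ q)"
  shows "vec.dim (range ((*v) M)) \<le> R"
proof -
  have "M *v w = (\<Sum>t=1..R. (\<Sum>q\<in>UNIV. y t $ q * w $ q) *s x t)" for w
  proof -
    have "(M *v w) $ p = (\<Sum>t=1..R. (\<Sum>q\<in>UNIV. y t $ q * w $ q) *s x t) $ p" for p
    proof -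
      have "(M *v w) $ p = (\<Sum>q\<in>UNIV. \<Sum>t=1..R. y t $ q * w $ q * x t $ p)"
        by (simp add: matrix_vector_mult_def assms sum_distrib_left sum_distrib_right mult_ac)
      also have "\<dots> = (\<Sum>t=1..R. \<Sum>q\<in>UNIV. y t $ q * w $ q * x t $ p)"
        by (rule sum.swap)
      finally show ?thesis by (simp add: sum_distrib_right)
    qed
    then show ?thesis by (simp add: vec_eq_iff)
  qed
  moreover have "(\<Sum>t=1..R. f t *s x t) \<in> vec.span (x ` {1..R})" for f
    by (intro vec.span_sum vec.span_scale vec.span_base imageI)
  ultimately have "range ((*v) M) \<subseteq> vec.span (x ` {1..R})"
    by force
  then have "vec.dim (range ((*v) M)) \<le> card (x ` {1..R})"
    by (intro vec.dim_le_card) auto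
  also have "\<dots> \<le> R" using card_image_le[of "{1..R}" x] by simp
  finally show ?thesis .
qed

text \<open>
  The \<open>v p\<close> are a basis of the row space and the \<open>u p\<close> collect the coordinates of the rows in it.
\<close>

lemma rank_factorization:
  fixes M :: "'a::field^'n^'m"
  obtains u v where "\<And>i j. M $ i $ j = (\<Sum>p=1..rank M. u p $ i * v p $ j)"
proof -
  obtain B where B: "vec.independent B" "rows M \<subseteq> vec.span B" "card B = rank M"
    using vec.basis_exists[of "rows M"] unfolding row_rank_def_gen by metis
  have fin: "finite B" using B(1) by (rule vec.finiteI_independent)
  then obtain v where v: "bij_betw v {1..rank M} B"
    using ex_bij_betw_nat_finite_1 B(3) by metis
  have "\<exists>f. M $ i = (\<Sum>b\<in>B. f b *s b)" for i
  proof -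
    have "row i M \<in> vec.span B" using B(2) by (auto simp: rows_def)
    moreover have "row i M = M $ i" by (simp add: row_def vec_eq_iff)
    ultimately show ?thesis by (auto simp: vec.span_finite[OF fin])
  qed
  then obtain f where f: "\<And>i. M $ i = (\<Sum>b\<in>B. f i b *s b)" by metis
  have "M $ i $ j = (\<Sum>p=1..rank M. (\<chi> i. f i (v p)) $ i * v p $ j)" for i j
  proof -
    have "M $ i = (\<Sum>p=1..rank M. f i (v p) *s v p)"
      unfolding f[of i] by (rule sum.reindex_bij_betw[OF v, symmetric])
    then show ?thesis by simp
  qed
  then show thesis by (rule that)
qed

section \<open>The two tensor ranks\<close>

lemma vec_outer_nth [simp]: "vec_outer a b c d $ i $ j $ k $ l = a $ i * b $ j * c $ k * d $ l"
  by (simp add: vec_outer_def)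

lemma mat_outer_cnj_nth [simp]:
  "mat_outer X (mat_cnj Y) $ i $ j $ k $ l = X $ i $ j * cnj (Y $ k $ l)"
  by (simp add: mat_outer_def mat_cnj_def)

lemma CP_decomposition_renumber:
  fixes A :: "('n::finite) tensor4"
  assumes "finite T" "A = (\<Sum>t\<in>T. vec_outer (a t) (b t) (c t) (d t))"
  shows "\<exists>(a :: nat \<Rightarrow> complex^'n) b c d.
    A = (\<Sum>i=1..card T. vec_outer (a i) (b i) (c i) (d i))"
proof -
  obtain g where g: "bij_betw g {1..card T} T"
    using ex_bij_betw_nat_finite_1[OF assms(1)] by blast
  have "A = (\<Sum>i=1..card T. vec_outer (a (g i)) (b (g i)) (c (g i)) (d (g i)))"
    unfolding assms(2) by (rule sum.reindex_bij_betw[OF g, symmetric])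
  then show ?thesis by (intro exI)
qed

text \<open>
  Writing \<open>E i\<close> as a sum of \<open>u i p v i p\<^sup>T\<close> over \<open>p = 1..rank (E i)\<close> and multiplying out
  \<open>E i \<circ> cnj (E i)\<close> gives one term for each pair \<open>(p, q)\<close>; the real weight is absorbed
  into the first factor. Indexing by triples \<open>(i, p, q)\<close> allows a different rank for each \<open>i\<close>.
\<close>

lemma CP_decomposition_of_matrix_decomposition:
  fixes A :: "('n::finite) tensor4" and c :: "'i \<Rightarrow> real"
  assumes fin: "finite I" and A: "A = (\<Sum>i\<in>I. c i *\<^sub>R mat_outer (E i) (mat_cnj (E i)))"
  obtains T :: "('i \<times> nat \<times> nat) set" and u v w x where "finite T"
    "A = (\<Sum>t\<in>T. vec_outer (u t) (v t) (w t) (x t))" "card T = (\<Sum>i\<in>I. (rank (E i))\<^sup>2)"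
proof -
  have "\<exists>u v. \<forall>j k. E i $ j $ k = (\<Sum>p=1..rank (E i). u p $ j * v p $ k)" for i
    using rank_factorization[of "E i"] by metis
  then obtain u v where
    E: "\<And>i j k. E i $ j $ k = (\<Sum>p=1..rank (E i). u i p $ j * v i p $ k)" by metis
  define conj :: "complex^'n \<Rightarrow> complex^'n" where "conj x = (\<chi> j. cnj (x $ j))" for x
  define S where "S i = {1..rank (E i)} \<times> {1..rank (E i)}" for i
  define U where "U = (\<lambda>(i, p, q :: nat). c i *\<^sub>R u i p)"
  define V where "V = (\<lambda>(i, p, q :: nat). v i p)"
  define W where "W = (\<lambda>(i, p :: nat, q). conj (u i q))"
  define X where "X = (\<lambda>(i, p :: nat, q). conj (v i q))"
  have summand: "c i *\<^sub>R mat_outer (E i) (mat_cnj (E i)) =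
      (\<Sum>s\<in>S i. vec_outer (U (i, s)) (V (i, s)) (W (i, s)) (X (i, s)))" for i
  proof -
    have "(c i *\<^sub>R mat_outer (E i) (mat_cnj (E i))) $ j $ k $ l $ m =
        (\<Sum>s\<in>S i. vec_outer (U (i, s)) (V (i, s)) (W (i, s)) (X (i, s))) $ j $ k $ l $ m"
      for j k l m
    proof -
      have "(c i *\<^sub>R mat_outer (E i) (mat_cnj (E i))) $ j $ k $ l $ m =
          c i *\<^sub>R ((\<Sum>p=1..rank (E i). u i p $ j * v i p $ k) *
            (\<Sum>q=1..rank (E i). cnj (u i q $ l) * cnj (v i q $ m)))"
        by (simp add: E)
      also have "\<dots> = (\<Sum>(p, q)\<in>S i. c i *\<^sub>R (u i p $ j * v i p $ k *
            (cnj (u i q $ l) * cnj (v i q $ m))))"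
        by (simp add: S_def sum_product sum.cartesian_product scaleR_sum_right case_prod_unfold)
      also have "\<dots> = (\<Sum>s\<in>S i. vec_outer (U (i, s)) (V (i, s)) (W (i, s)) (X (i, s))) $ j $ k $ l $ m"
        by (simp add: U_def V_def W_def X_def conj_def case_prod_unfold mult_ac)
      finally show ?thesis .
    qed
    then show ?thesis by (simp add: vec_eq_iff)
  qed
  have finS: "finite (S i)" for i by (simp add: S_def)
  have "A = (\<Sum>t\<in>Sigma I S. vec_outer (U t) (V t) (W t) (X t))"
    unfolding A summand using fin finS by (simp add: sum.Sigma case_prod_unfold)
  moreover have "card (Sigma I S) = (\<Sum>i\<in>I. (rank (E i))\<^sup>2)"
    using fin finS by (simp add: S_def power2_eq_square)
  ultimately show thesis using fin finS by (intro that) auto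
qed

text \<open>
  The CP terms bound the dimension of the range of \<open>M\<close>, which yields the number of terms; the
  \<open>F t\<close> are symmetric because they are values of \<open>M\<close>, whose rows \<open>(i, j)\<close> and \<open>(j, i)\<close> agree.
\<close>

lemma rank_M_le_CP_length:
  fixes A :: "('n::finite) tensor4"
  assumes cps: "cps A" and A: "A = (\<Sum>t=1..R. vec_outer (a t) (b t) (c t) (d t))"
  shows "rank_M A \<le> R"
proof -
  define M :: "complex^('n \<times> 'n)^('n \<times> 'n)"
    where "M = (\<chi> p q. A $ fst p $ snd p $ fst q $ snd q)"
  have M_nth: "M $ (i, j) $ (k, l) = A $ i $ j $ k $ l" for i j k l
    by (simp add: M_def)
  have herm: "hermitian M"
    unfolding hermitian_def M_def vec_lambda_beta using cps unfolding cps_def by blast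
  have "M $ p $ q = (\<Sum>t=1..R. (\<chi> p. a t $ fst p * b t $ snd p) $ p *
      (\<chi> q. c t $ fst q * d t $ snd q) $ q)" for p q
    by (simp add: M_def A mult_ac)
  then have "vec.dim (range ((*v) M)) \<le> R"
    by (rule dim_range_sum_rank_one)
  from hermitian_sum_rank_one[OF herm this] obtain \<gamma> :: "nat \<Rightarrow> real" and e where
    e: "\<And>t. e t \<in> range ((*v) M)" and
    M: "\<And>p q. M $ p $ q = (\<Sum>t=1..R. of_real (\<gamma> t) * e t $ p * cnj (e t $ q))" by blast
  define F where "F t = (\<chi> i j. e t $ (i, j))" for t
  have "e t $ (i, j) = e t $ (j, i)" for t i j
  proof -
    obtain w where "e t = M *v w" using e[of t] by blast
    moreover have "M $ (i, j) $ q = M $ (j, i) $ q" for q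
      unfolding M_def vec_lambda_beta fst_conv snd_conv using cps unfolding cps_def by blast
    ultimately show ?thesis by (simp add: matrix_vector_mult_def)
  qed
  then have "\<forall>t\<in>{1..R}. transpose (F t) = F t"
    by (simp add: F_def transpose_def vec_eq_iff)
  moreover have "A = (\<Sum>t=1..R. \<gamma> t *\<^sub>R mat_outer (F t) (mat_cnj (F t)))"
    by (simp add: vec_eq_iff F_def M_nth[symmetric] M) (simp add: scaleR_conv_of_real mult_ac)
  ultimately show ?thesis
    unfolding rank_M_def by (intro Least_le exI conjI)
qed

theorem theorem10:
  fixes A :: "('n::finite) tensor4"
    and c :: "nat \<Rightarrow> real"
    and E :: "nat \<Rightarrow> complex^'n^'n"
  assumes "cps A"
    and "\<And>i. i \<in> {1..rank_M A} \<Longrightarrow> transpose (E i) = E i"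
    and "A = (\<Sum>i=1..rank_M A. c i *\<^sub>R mat_outer (E i) (mat_cnj (E i)))"
  shows "rank_M A \<le> rank_CP A \<and>
         rank_CP A \<le> (Max ((\<lambda>i. rank (E i)) ` {1..rank_M A}))\<^sup>2 * rank_M A"
proof
  let ?r = "Max ((\<lambda>i. rank (E i)) ` {1..rank_M A})"
  obtain T :: "(nat \<times> nat \<times> nat) set" and u v w x where T: "finite T"
    "A = (\<Sum>t\<in>T. vec_outer (u t) (v t) (w t) (x t))"
    "card T = (\<Sum>i=1..rank_M A. (rank (E i))\<^sup>2)"
    using CP_decomposition_of_matrix_decomposition[OF finite_atLeastAtMost assms(3)] .
  \<comment> \<open>If \<open>rank_M A = 0\<close>, then \<open>?r\<close> is the maximum of the empty set, an unspecified number, but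
    both sums are empty.\<close>
  have "card T \<le> (\<Sum>i=1..rank_M A. ?r\<^sup>2)"
    unfolding T(3) by (intro sum_mono power_mono Max_ge) auto
  also have "\<dots> = ?r\<^sup>2 * rank_M A" by simp
  finally have card: "card T \<le> ?r\<^sup>2 * rank_M A" .
  note CP = CP_decomposition_renumber[OF T(1,2)]
  have "rank_CP A \<le> card T"
    unfolding rank_CP_def using CP by (rule Least_le)
  with card show "rank_CP A \<le> ?r\<^sup>2 * rank_M A" by linarith
  \<comment> \<open>The existence of some CP decomposition is what makes the minimum \<open>rank_CP A\<close> attained.\<close>
  have "\<exists>(a :: nat \<Rightarrow> complex^'n) b c d. A = (\<Sum>i=1..rank_CP A. vec_outer (a i) (b i) (c i) (d i))"
    unfolding rank_CP_def using CP by (rule LeastI)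
  then show "rank_M A \<le> rank_CP A"
    by (elim exE) (rule rank_M_le_CP_length[OF assms(1)])
qed

end
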